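(* Let $\Gamma$ be a simply-laced Dynkin graph with Weyl group $W$ and coweight lattice $P_\Gamma$, and let $\lambda\in P_\Gamma$. There exists a $\lambda$-minuscule element $w\in W$ such that $w(\lambda)$ is dominant if and only if (i) $\langle\lambda,\alpha_i^\vee\rangle\ge -1$ for every simple root $\alpha_i$, and (ii) for every connected subdiagram $\Gamma'\subseteq\Gamma$, the restriction $\lambda|_{\Gamma'}\in P_{\Gamma'}$ is not a negative coroot (that is, $\lambda|_{\Gamma'}\neq-\alpha^\vee$ for every positive root $\alpha$ of $\Gamma'$).
   Context: A simply-laced Dynkin graph is a graph of type $A_n$ ($n\ge 1$), $D_n$ ($n \geq 4$), $E_6$, $E_7$ or $E_8$, with vertex set $I$, simple roots $\alpha_i$ ($i\in I$), root lattice $R_\Gamma=\bigoplus_i \mathbb{Z}\alpha_i$, and Cartan form given by $\langle \alpha_i,\alpha_i\rangle=2$, $\langle\alpha_i,\alpha_j\rangle=-1$ if $i,j$ are adjacent, and $0$ otherwise. The positive roots are the $\alpha\in\mathbb{Z}_{\ge 0}^I$ with $\langle\alpha,\alpha\rangle=2$, where $\mathbb{Z}^I$ is identified with $R_\Gamma$. $P_\Gamma$ is the lattice of coweights, i.e. the dual $\mathrm{Hom}(R_\Gamma,\mathbb{Z})$ of the root lattice. For $\lambda\in P_\Gamma$ and a root $\alpha$, $\langle\lambda,\alpha^\vee\rangle$ denotes the pairing of $\lambda$ with $\alpha$ (the notation uses the identification of roots and coroots in the simply-laced case). The coroot $\alpha^\vee\in P_\Gamma$ is the element whose pairing with each $\beta\in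 R_\Gamma$ is $\langle\beta,\alpha\rangle$. The Weyl group $W$ is generated by the simple reflections $s_i$, acting on $P_\Gamma$ by $s_i(\lambda)=\lambda-\langle\lambda,\alpha_i^\vee\rangle\,\alpha_i^\vee$. A coweight $\lambda$ is dominant if $\langle\lambda,\alpha_i^\vee\rangle\ge 0$ for all $i\in I$. An element $w\in W$ is $\lambda$-minuscule if there is a reduced expression $w=s_{i_1}s_{i_2}\cdots s_{i_t}$ ($t\ge 0$) such that $s_{i_r}s_{i_{r+1}}\cdots s_{i_t}\lambda=\lambda+\alpha_{i_r}^\vee+\cdots+\alpha_{i_t}^\vee$ for all $r\in\{1,\dots,t\}$. A connected subdiagram $\Gamma'$ is the full subgraph on a nonempty set of vertices that is connected; it is again a simply-laced Dynkin graph. The restriction $\lambda|_{\Gamma'}\in P_{\Gamma'}$ is the unique element with $\langle\lambda|_{\Gamma'},\alpha_i^\vee\rangle=\langle\lambda,\alpha_i^\vee\rangle$ for all vertices $i$ of $\Gamma'$. *)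

theory Defs
  imports Main "HOL-Library.Function_Algebras" "HOL-Algebra.Bij" "HOL-Algebra.Generated_Groups"
begin

text \<open>
  A graph is given by a vertex set \<open>I\<close> and an adjacency relation \<open>adj\<close>. No definition below looks
  at \<open>adj\<close> outside \<open>I\<close>, so the full subgraph on \<open>S \<subseteq> I\<close> is given by \<open>S\<close> and the same \<open>adj\<close>.
\<close>

definition graph_iso ::
  "'a set \<Rightarrow> ('a \<Rightarrow> 'a \<Rightarrow> bool) \<Rightarrow> 'b set \<Rightarrow> ('b \<Rightarrow> 'b \<Rightarrow> bool) \<Rightarrow> bool" where
  "graph_iso I adj J adj' \<longleftrightarrow>
     (\<exists>f. bij_betw f I J \<and> (\<forall>i\<in>I. \<forall>j\<in>I. adj i j \<longleftrightarrow> adj' (f i) (f j)))"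

definition path_adj :: "nat \<Rightarrow> nat \<Rightarrow> bool" where
  "path_adj i j \<longleftrightarrow> j = Suc i \<or> i = Suc j"

text \<open>On \<open>{..<n}\<close>: the path \<open>0, \<dots>, n - 2\<close> with one further vertex \<open>n - 1\<close> attached to \<open>k\<close>.
  The branch vertex is \<open>k = n - 3\<close> for \<open>D\<^sub>n\<close> and \<open>k = 2\<close> for \<open>E\<^sub>n\<close>.\<close>

definition branched_path_adj :: "nat \<Rightarrow> nat \<Rightarrow> nat \<Rightarrow> nat \<Rightarrow> bool" where
  "branched_path_adj n k i j \<longleftrightarrow>
     (i < n - 1 \<and> j < n - 1 \<and> path_adj i j) \<or> (i = n - 1 \<and> j = k) \<or> (i = k \<and> j = n - 1)"

definition simply_laced_dynkin :: "'a set \<Rightarrow> ('a \<Rightarrow> 'a \<Rightarrow> bool) \<Rightarrow> bool" where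
  "simply_laced_dynkin I adj \<longleftrightarrow>
     (\<exists>n\<ge>1. graph_iso I adj {..<n} path_adj) \<or>
     (\<exists>n\<ge>4. graph_iso I adj {..<n} (branched_path_adj n (n - 3))) \<or>
     (\<exists>n\<in>{6, 7, 8}. graph_iso I adj {..<n} (branched_path_adj n 2))"

definition connected_subdiagram :: "'a set \<Rightarrow> ('a \<Rightarrow> 'a \<Rightarrow> bool) \<Rightarrow> 'a set \<Rightarrow> bool" where
  "connected_subdiagram I adj S \<longleftrightarrow>
     S \<subseteq> I \<and> S \<noteq> {} \<and>
     (\<forall>i\<in>S. \<forall>j\<in>S. (i, j) \<in> {(x, y). x \<in> S \<and> y \<in> S \<and> adj x y}\<^sup>*)"

text \<open>An element \<open>\<Sum>i\<in>I. x i \<cdot> \<alpha>\<^sub>i\<close> of the root lattice is encoded by its coefficient function \<open>x\<close>,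
  extended by zero outside \<open>I\<close>.\<close>

definition root_lattice :: "'a set \<Rightarrow> ('a \<Rightarrow> int) set" where
  "root_lattice I = {x. \<forall>i. i \<notin> I \<longrightarrow> x i = 0}"

definition simple_root :: "'a \<Rightarrow> 'a \<Rightarrow> int" where
  "simple_root i = (\<lambda>j. if j = i then 1 else 0)"

definition cartan_entry :: "('a \<Rightarrow> 'a \<Rightarrow> bool) \<Rightarrow> 'a \<Rightarrow> 'a \<Rightarrow> int" where
  "cartan_entry adj i j = (if i = j then 2 else if adj i j then -1 else 0)"

definition cartan_form ::
  "'a set \<Rightarrow> ('a \<Rightarrow> 'a \<Rightarrow> bool) \<Rightarrow> ('a \<Rightarrow> int) \<Rightarrow> ('a \<Rightarrow> int) \<Rightarrow> int" where
  "cartan_form I adj x y = (\<Sum>i\<in>I. \<Sum>j\<in>I. x i * y j * cartan_entry adj i j)"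

definition positive_roots :: "'a set \<Rightarrow> ('a \<Rightarrow> 'a \<Rightarrow> bool) \<Rightarrow> ('a \<Rightarrow> int) set" where
  "positive_roots I adj =
     {x \<in> root_lattice I. (\<forall>i\<in>I. 0 \<le> x i) \<and> cartan_form I adj x x = 2}"

text \<open>The group \<open>Hom(R, \<int>)\<close>, with homomorphisms extended by zero outside the root lattice \<open>R\<close> so
  that equality and the group operations are those of functions. The pairing of a coweight \<open>\<lambda>\<close>
  with \<open>x \<in> R\<close> is the application \<open>\<lambda> x\<close>.\<close>

definition coweights :: "'a set \<Rightarrow> (('a \<Rightarrow> int) \<Rightarrow> int) set" where
  "coweights I =
     {l. (\<forall>x\<in>root_lattice I. \<forall>y\<in>root_lattice I. l (x + y) = l x + l y) \<and>
         (\<forall>x. x \<notin> root_lattice I \<longrightarrow> l x = 0)}"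

definition coroot ::
  "'a set \<Rightarrow> ('a \<Rightarrow> 'a \<Rightarrow> bool) \<Rightarrow> ('a \<Rightarrow> int) \<Rightarrow> (('a \<Rightarrow> int) \<Rightarrow> int)" where
  "coroot I adj a = (\<lambda>x. if x \<in> root_lattice I then cartan_form I adj x a else 0)"

definition dominant :: "'a set \<Rightarrow> (('a \<Rightarrow> int) \<Rightarrow> int) \<Rightarrow> bool" where
  "dominant I l \<longleftrightarrow> (\<forall>i\<in>I. l (simple_root i) \<ge> 0)"

definition restrict_coweight ::
  "'a set \<Rightarrow> (('a \<Rightarrow> int) \<Rightarrow> int) \<Rightarrow> (('a \<Rightarrow> int) \<Rightarrow> int)" where
  "restrict_coweight S l =
     (THE m. m \<in> coweights S \<and> (\<forall>i\<in>S. m (simple_root i) = l (simple_root i)))"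

text \<open>The Weyl group is realised as a group of permutations of the coweight lattice.\<close>

definition simple_reflection ::
  "'a set \<Rightarrow> ('a \<Rightarrow> 'a \<Rightarrow> bool) \<Rightarrow> 'a \<Rightarrow> (('a \<Rightarrow> int) \<Rightarrow> int) \<Rightarrow> (('a \<Rightarrow> int) \<Rightarrow> int)" where
  "simple_reflection I adj i =
     (\<lambda>l\<in>coweights I. \<lambda>x. l x - l (simple_root i) * coroot I adj (simple_root i) x)"

definition weyl_group ::
  "'a set \<Rightarrow> ('a \<Rightarrow> 'a \<Rightarrow> bool) \<Rightarrow> ((('a \<Rightarrow> int) \<Rightarrow> int) \<Rightarrow> (('a \<Rightarrow> int) \<Rightarrow> int)) set" where
  "weyl_group I adj = generate (BijGroup (coweights I)) (simple_reflection I adj ` I)"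

definition word_prod ::
  "'a set \<Rightarrow> ('a \<Rightarrow> 'a \<Rightarrow> bool) \<Rightarrow> 'a list \<Rightarrow> (('a \<Rightarrow> int) \<Rightarrow> int) \<Rightarrow> (('a \<Rightarrow> int) \<Rightarrow> int)" where
  "word_prod I adj is =
     foldr (\<lambda>i w. simple_reflection I adj i \<otimes>\<^bsub>BijGroup (coweights I)\<^esub> w) is
       \<one>\<^bsub>BijGroup (coweights I)\<^esub>"

definition reduced_expression ::
  "'a set \<Rightarrow> ('a \<Rightarrow> 'a \<Rightarrow> bool) \<Rightarrow> 'a list \<Rightarrow>
    ((('a \<Rightarrow> int) \<Rightarrow> int) \<Rightarrow> (('a \<Rightarrow> int) \<Rightarrow> int)) \<Rightarrow> bool" where
  "reduced_expression I adj is w \<longleftrightarrow>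
     is \<in> lists I \<and> word_prod I adj is = w \<and>
     (\<forall>js\<in>lists I. word_prod I adj js = w \<longrightarrow> length is \<le> length js)"

text \<open>List positions are counted from zero, so \<open>drop r is\<close> is the suffix of the
  expression starting with its \<open>(r + 1)\<close>-st letter.\<close>

definition minuscule ::
  "'a set \<Rightarrow> ('a \<Rightarrow> 'a \<Rightarrow> bool) \<Rightarrow> (('a \<Rightarrow> int) \<Rightarrow> int) \<Rightarrow>
    ((('a \<Rightarrow> int) \<Rightarrow> int) \<Rightarrow> (('a \<Rightarrow> int) \<Rightarrow> int)) \<Rightarrow> bool" where
  "minuscule I adj l w \<longleftrightarrow>
     (\<exists>is. reduced_expression I adj is w \<and>
        (\<forall>r<length is.
           word_prod I adj (drop r is) l =
             l + (\<Sum>i\<leftarrow>drop r is. coroot I adj (simple_root i))))"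

text \<open>The operations of \<open>BijGroup\<close> are meaningful only on \<open>Bij\<close>, and the description defining
  \<open>restrict_coweight\<close> needs existence and uniqueness; both are checked here.\<close>

lemma root_lattice_add: "x \<in> root_lattice I \<Longrightarrow> y \<in> root_lattice I \<Longrightarrow> x + y \<in> root_lattice I"
  by (simp add: root_lattice_def)

lemma cartan_form_add_left: "cartan_form I adj (x + y) z = cartan_form I adj x z + cartan_form I adj y z"
  by (simp add: cartan_form_def distrib_right sum.distrib)

lemma coroot_coweights: "coroot I adj a \<in> coweights I"
  by (auto simp: coweights_def coroot_def root_lattice_add cartan_form_add_left)

lemma simple_root_root_lattice: "i \<in> I \<Longrightarrow> simple_root i \<in> root_lattice I"
  by (auto simp: root_lattice_def simple_root_def)

lemma cartan_form_simple_root: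
  assumes "finite I" "i \<in> I" "j \<in> I"
  shows "cartan_form I adj (simple_root i) (simple_root j) = cartan_entry adj i j"
proof -
  have "cartan_form I adj (simple_root i) (simple_root j)
      = (\<Sum>k\<in>I. \<Sum>m\<in>I. if m = j then (if k = i then cartan_entry adj i j else 0) else 0)"
    unfolding cartan_form_def simple_root_def by (intro sum.cong) auto
  also have "\<dots> = cartan_entry adj i j" using assms by (simp add: sum.delta)
  finally show ?thesis .
qed

lemma simple_reflection_Bij:
  assumes "finite I" "i \<in> I"
  shows "simple_reflection I adj i \<in> Bij (coweights I)"
proof -
  let ?s = "simple_reflection I adj i" and ?c = "coroot I adj (simple_root i)"
  have c2: "?c (simple_root i) = 2"
    using assms by (simp add: coroot_def simple_root_root_lattice cartan_form_simple_root cartan_entry_def)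
  have closed: "?s l \<in> coweights I" if l: "l \<in> coweights I" for l
    using l coroot_coweights[of I adj "simple_root i"]
    by (auto simp: simple_reflection_def coweights_def algebra_simps)
  have inv: "?s (?s l) = l" if l: "l \<in> coweights I" for l
  proof
    fix x
    have s: "?s m x = m x - m (simple_root i) * ?c x" if "m \<in> coweights I" for m x
      using that by (simp add: simple_reflection_def)
    show "?s (?s l) x = l x" unfolding s[OF closed[OF l]] s[OF l] c2 by (simp add: algebra_simps)
  qed
  have "bij_betw ?s (coweights I) (coweights I)"
    by (rule bij_betw_byWitness[where f' = ?s]) (auto simp: closed inv)
  then show ?thesis by (simp add: Bij_def simple_reflection_def)
qed

lemma coweights_eqI:
  assumes "finite S" "l \<in> coweights S" "m \<in> coweights S" "\<And>i. i \<in> S \<Longrightarrow> l (simple_root i) = m (simple_root i)"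
  shows "l = m"
proof
  have gen: "l x = m x" if "finite T" "T \<subseteq> S" "\<And>i. i \<notin> T \<Longrightarrow> x i = 0" for T x
    using that
  proof (induction T arbitrary: x rule: finite_induct)
    case empty
    then have "x = 0" by (auto simp: fun_eq_iff)
    moreover have "h 0 = 0" if "h \<in> coweights S" for h
    proof -
      have z: "(0::'a \<Rightarrow> int) \<in> root_lattice S" by (simp add: root_lattice_def)
      have "\<forall>x\<in>root_lattice S. \<forall>y\<in>root_lattice S. h (x + y) = h x + h y"
        using that unfolding coweights_def by blast
      from bspec[OF bspec[OF this z] z] have "h (0 + 0) = h 0 + h 0" .
      then show ?thesis by simp
    qed
    ultimately show ?case using assms(2,3) by metis
  next
    case (insert i T)
    have i: "i \<in> S" using insert by auto
    have add: "h (u + v) = h u + h v"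
      if "h \<in> coweights S" "u \<in> root_lattice S" "v \<in> root_lattice S" for h u v
      using that by (auto simp: coweights_def)
    define n where "n = (\<lambda>(k::int) j. if j = i then k else 0)"
    have nR: "n k \<in> root_lattice S" for k using i by (simp add: root_lattice_def n_def)
    have n1: "n 1 = simple_root i" by (auto simp: simple_root_def n_def)
    have n_add: "n (j + k) = n j + n k" for j k by (auto simp: fun_eq_iff n_def)
    have hs: "h (n (k + 1)) = h (n k) + h (simple_root i)" if "h \<in> coweights S" for h k
      unfolding n_add n1[symmetric] by (rule add[OF that nR nR])
    have eq: "l (n k) = m (n k)" for k
    proof (induction k rule: int_induct[where k = 0])
      case base
      show ?case using hs[OF assms(2), of 0] hs[OF assms(3), of 0] n1 assms(4)[OF i] by simp
    next
      case (step1 k)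
      then show ?case unfolding hs[OF assms(2)] hs[OF assms(3)] assms(4)[OF i] by simp
    next
      case (step2 k)
      then show ?case
        using hs[OF assms(2), of "k - 1"] hs[OF assms(3), of "k - 1"] assms(4)[OF i] by simp
    qed
    define y where "y = x(i := 0)"
    have yR: "y \<in> root_lattice S" using insert.prems by (auto simp: root_lattice_def y_def)
    have x: "y + n (x i) = x" by (auto simp: fun_eq_iff y_def n_def)
    have ly: "l y = m y" using insert.prems by (intro insert.IH) (auto simp: y_def)
    have "l (y + n (x i)) = m (y + n (x i))"
      unfolding add[OF assms(2) yR nR] add[OF assms(3) yR nR] eq ly by (rule refl)
    then show ?case unfolding x .
  qed
  fix x
  show "l x = m x"
  proof (cases "x \<in> root_lattice S")
    case True then show ?thesis using gen[OF assms(1), of x] by (auto simp: root_lattice_def)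
  next
    case False then show ?thesis using assms(2,3) by (simp add: coweights_def)
  qed
qed

lemma restrict_coweight_eq:
  assumes "finite I" "S \<subseteq> I" "l \<in> coweights I"
  shows "restrict_coweight S l = (\<lambda>x. if x \<in> root_lattice S then l x else 0)" (is "_ = ?m")
proof -
  have m_mem: "?m \<in> coweights S"
  proof -
    have "root_lattice S \<subseteq> root_lattice I" using assms(2) by (auto simp: root_lattice_def)
    then show ?thesis using assms(3) by (simp add: coweights_def root_lattice_add subset_iff)
  qed
  have m_simple: "?m (simple_root i) = l (simple_root i)" if "i \<in> S" for i
    using that by (simp add: simple_root_root_lattice)
  show ?thesis
    unfolding restrict_coweight_def
  proof (rule the_equality)
    show "?m \<in> coweights S \<and> (\<forall>i\<in>S. ?m (simple_root i) = l (simple_root i))"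
      using m_mem m_simple by blast
  next
    fix m
    assume m: "m \<in> coweights S \<and> (\<forall>i\<in>S. m (simple_root i) = l (simple_root i))"
    show "m = ?m"
    proof (rule coweights_eqI[OF finite_subset[OF assms(2,1)] _ m_mem])
      show "m \<in> coweights S" using m by blast
    next
      fix i assume i: "i \<in> S"
      show "m (simple_root i) = ?m (simple_root i)" unfolding m_simple[OF i] using m i by blast
    qed
  qed
qed

end

theory Submission imports Defs Complex_Main begin

text \<open>
  A word is admissible for \<open>\<lambda>\<close> if each of its letters \<open>s\<^sub>i\<close> is applied to a coweight whose pairing with
  \<open>\<alpha>\<^sub>i\<close> is \<open>-1\<close>. Let \<open>N \<lambda>\<close> be the number of positive roots pairing negatively with \<open>\<lambda>\<close>. As \<open>s\<^sub>i\<close>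
  permutes the positive roots other than \<open>\<alpha>\<^sub>i\<close>, a reflection lowers \<open>N\<close> by at most one, and by exactly
  one if the pairing with \<open>\<alpha>\<^sub>i\<close> is negative. Hence admissible words are automatically reduced, and
  they cannot be prolonged forever.

  If an admissible word leads from \<open>\<lambda>\<close> to a dominant coweight, then working backwards along it shows
  that \<open>\<lambda>\<close> pairs to at least \<open>-1\<close> with every positive root; a restriction equal to \<open>-\<alpha>\<^sup>\<or>\<close> would pair
  to \<open>-2\<close> with \<open>\<alpha>\<close>. Conversely, apply admissible letters as long as possible. The only way to get
  stuck is a pairing \<open>-2\<close> with a simple root, i.e. a restriction to one vertex that is a negative
  coroot, and such an obstruction propagates backwards to \<open>\<lambda>\<close>.
\<close>

section \<open>Positive definiteness of the Cartan form\<close>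

definition pos_def_on :: "'a set \<Rightarrow> ('a \<Rightarrow> 'a \<Rightarrow> bool) \<Rightarrow> bool" where
  "pos_def_on S adj \<longleftrightarrow> (\<forall>x. (\<exists>i\<in>S. x i \<noteq> 0) \<longrightarrow> cartan_form S adj x x > 0)"

text \<open>The constant \<open>d\<close> controls the coordinate at the vertex \<open>v\<close>
  where further vertices will be attached, which makes positive definiteness inductive along a tree.
  The best such \<open>d\<close> is the reciprocal of the \<open>(v, v)\<close> entry of the inverse
  Cartan matrix.\<close>

definition anchored_bound :: "'a set \<Rightarrow> ('a \<Rightarrow> 'a \<Rightarrow> bool) \<Rightarrow> 'a \<Rightarrow> real \<Rightarrow> bool" where
  "anchored_bound S adj v d \<longleftrightarrow> finite S \<and> v \<in> S \<and> pos_def_on S adj \<and>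
     (\<forall>x. d * (real_of_int (x v))\<^sup>2 \<le> real_of_int (cartan_form S adj x x))"

lemma cartan_form_cong:
  assumes "\<And>i. i \<in> S \<Longrightarrow> x i = x' i" "\<And>i. i \<in> S \<Longrightarrow> y i = y' i"
  shows "cartan_form S adj x y = cartan_form S adj x' y'"
  unfolding cartan_form_def using assms by (intro sum.cong) auto

lemma cartan_form_insert:
  assumes "finite S" "u \<notin> S" "\<And>j. j \<in> S \<Longrightarrow> adj j u \<longleftrightarrow> adj u j"
  shows "cartan_form (insert u S) adj x x =
    cartan_form S adj x x + 2 * (x u)\<^sup>2 + 2 * x u * (\<Sum>j\<in>S. x j * cartan_entry adj u j)"
proof -
  have sym: "(\<Sum>i\<in>S. x i * x u * cartan_entry adj i u) = x u * (\<Sum>j\<in>S. x j * cartan_entry adj u j)"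
    unfolding sum_distrib_left using assms by (intro sum.cong) (auto simp: cartan_entry_def)
  have "cartan_form (insert u S) adj x x =
      2 * (x u)\<^sup>2 + (\<Sum>j\<in>S. x u * x j * cartan_entry adj u j)
      + ((\<Sum>i\<in>S. x i * x u * cartan_entry adj i u) + cartan_form S adj x x)"
    using assms by (simp add: cartan_form_def sum.distrib cartan_entry_def power2_eq_square)
  also have "(\<Sum>j\<in>S. x u * x j * cartan_entry adj u j) = x u * (\<Sum>j\<in>S. x j * cartan_entry adj u j)"
    by (simp add: sum_distrib_left mult.assoc)
  finally show ?thesis by (simp add: sym)
qed

lemma cartan_form_insert_pendant:
  assumes "finite S" "u \<notin> S" "v \<in> S"
    and "\<And>j. j \<in> S \<Longrightarrow> adj u j \<longleftrightarrow> j = v" "\<And>j. j \<in> S \<Longrightarrow> adj j u \<longleftrightarrow> j = v"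
  shows "cartan_form (insert u S) adj x x = cartan_form S adj x x + 2 * (x u)\<^sup>2 - 2 * x u * x v"
proof -
  have "(\<Sum>j\<in>S. x j * cartan_entry adj u j) = (\<Sum>j\<in>S. if j = v then - x v else 0)"
    using assms by (intro sum.cong) (auto simp: cartan_entry_def)
  also have "\<dots> = - x v" using assms by simp
  finally show ?thesis using assms by (simp add: cartan_form_insert)
qed

text \<open>Diagonal entries are 2 and, by symmetry, each off-diagonal product occurs twice.
  Evenness later raises the norm of a nonzero vector from positive to at least 2.\<close>

lemma even_cartan_form:
  assumes "finite S" "\<And>i j. i \<in> S \<Longrightarrow> j \<in> S \<Longrightarrow> adj i j \<Longrightarrow> adj j i"
  shows "even (cartan_form S adj x x)"
  using assms
proof (induction S rule: finite_induct)
  case empty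
  then show ?case by (simp add: cartan_form_def)
next
  case (insert u S)
  have "cartan_form (insert u S) adj x x =
    cartan_form S adj x x + 2 * (x u)\<^sup>2 + 2 * x u * (\<Sum>j\<in>S. x j * cartan_entry adj u j)"
    using insert by (intro cartan_form_insert) auto
  moreover have "even (cartan_form S adj x x)" using insert by auto
  ultimately show ?case by simp
qed

lemma anchored_bound_singleton: "anchored_bound {v} adj v 2"
  by (auto simp: anchored_bound_def pos_def_on_def cartan_form_def cartan_entry_def power2_eq_square
      zero_less_mult_iff linorder_neq_iff)

text \<open>Completing the square in \<open>x v\<close> leaves \<open>2 - 1 / d\<close> times the
  square of \<open>x u\<close>. This coefficient is positive because \<open>d > 1 / 2\<close>, which
  settles \<open>x u \<noteq> 0\<close>; otherwise the form is that of \<open>S\<close>.\<close>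

lemma anchored_bound_extend:
  assumes ab: "anchored_bound S adj v d" and d: "d > 1 / 2" and u: "u \<notin> S"
    and adj: "\<And>j. j \<in> S \<Longrightarrow> adj u j \<longleftrightarrow> j = v" "\<And>j. j \<in> S \<Longrightarrow> adj j u \<longleftrightarrow> j = v"
  shows "anchored_bound (insert u S) adj u (2 - 1 / d)"
proof -
  have fin: "finite S" and v: "v \<in> S" and pd: "pos_def_on S adj"
    and bd: "\<And>x. d * (real_of_int (x v))\<^sup>2 \<le> real_of_int (cartan_form S adj x x)"
    using ab by (auto simp: anchored_bound_def)
  have form: "cartan_form (insert u S) adj x x = cartan_form S adj x x + 2 * (x u)\<^sup>2 - 2 * x u * x v" for x
    using fin u v adj by (rule cartan_form_insert_pendant)
  have bound: "(2 - 1 / d) * (real_of_int (x u))\<^sup>2 \<le> real_of_int (cartan_form (insert u S) adj x x)" for x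
  proof -
    have "0 \<le> d * (real_of_int (x v) - real_of_int (x u) / d)\<^sup>2" using d by simp
    also have "\<dots> = d * (real_of_int (x v))\<^sup>2 - 2 * real_of_int (x u) * real_of_int (x v)
        + (real_of_int (x u))\<^sup>2 / d"
      using d by (simp add: power2_eq_square field_simps)
    finally show ?thesis using bd[of x] by (simp add: form left_diff_distrib)
  qed
  have "cartan_form (insert u S) adj x x > 0" if "\<exists>i\<in>insert u S. x i \<noteq> 0" for x
  proof (cases "x u = 0")
    case True
    then show ?thesis using pd that by (auto simp: form pos_def_on_def)
  next
    case False
    have "0 < (2 - 1 / d) * (real_of_int (x u))\<^sup>2"
      using False d by (simp add: field_simps)
    also note bound
    finally show ?thesis by simp
  qed
  then show ?thesis using fin bound by (auto simp: anchored_bound_def pos_def_on_def)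
qed

text \<open>Here the square is completed in \<open>x u\<close> instead, at a cost of
  \<open>1 / 2\<close>, so that the anchor stays at \<open>v\<close> and another branch can be glued
  there.\<close>

lemma anchored_bound_pendant:
  assumes ab: "anchored_bound S adj v d" and d: "d > 1 / 2" and u: "u \<notin> S"
    and adj: "\<And>j. j \<in> S \<Longrightarrow> adj u j \<longleftrightarrow> j = v" "\<And>j. j \<in> S \<Longrightarrow> adj j u \<longleftrightarrow> j = v"
  shows "anchored_bound (insert u S) adj v (d - 1 / 2)"
proof -
  have fin: "finite S" and v: "v \<in> S"
    and bd: "\<And>x. d * (real_of_int (x v))\<^sup>2 \<le> real_of_int (cartan_form S adj x x)"
    using ab by (auto simp: anchored_bound_def)
  have form: "cartan_form (insert u S) adj x x = cartan_form S adj x x + 2 * (x u)\<^sup>2 - 2 * x u * x v" for x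
    using fin u v adj by (rule cartan_form_insert_pendant)
  have "(d - 1 / 2) * (real_of_int (x v))\<^sup>2 \<le> real_of_int (cartan_form (insert u S) adj x x)" for x
  proof -
    have "0 \<le> 2 * (real_of_int (x u) - real_of_int (x v) / 2)\<^sup>2" by simp
    also have "\<dots> = (real_of_int (x v))\<^sup>2 / 2 - 2 * real_of_int (x u) * real_of_int (x v)
        + 2 * (real_of_int (x u))\<^sup>2"
      by (simp add: power2_eq_square field_simps)
    finally show ?thesis using bd[of x] by (simp add: form left_diff_distrib)
  qed
  moreover have "pos_def_on (insert u S) adj"
    using anchored_bound_extend[OF assms] by (simp add: anchored_bound_def)
  ultimately show ?thesis using fin v by (auto simp: anchored_bound_def)
qed

section \<open>Types A, D and E\<close>

lemma anchored_bound_path: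
  assumes "\<And>i j. i \<le> k \<Longrightarrow> j \<le> k \<Longrightarrow> adj i j \<longleftrightarrow> path_adj i j"
  shows "anchored_bound {..<Suc k} adj k ((real k + 2) / (real k + 1))"
  using assms
proof (induction k)
  case 0
  have "{..<Suc 0} = {0::nat}" by auto
  then show ?case using anchored_bound_singleton[of "0::nat" adj] by simp
next
  case (Suc k)
  have "anchored_bound (insert (Suc k) {..<Suc k}) adj (Suc k) (2 - 1 / ((real k + 2) / (real k + 1)))"
    by (rule anchored_bound_extend[OF Suc.IH])
      (use Suc.prems in \<open>auto simp: path_adj_def field_simps\<close>)
  \<comment> \<open>The numbers \<open>(k + 2) / (k + 1)\<close> solve the recursion
    \<open>d \<mapsto> 2 - 1 / d\<close> starting at 2; they are ratios of consecutive Cartan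
    determinants of type A.\<close>
  moreover have "2 - 1 / ((real k + 2) / (real k + 1)) = (real (Suc k) + 2) / (real (Suc k) + 1)"
    by (simp add: field_simps)
  ultimately show ?case by (simp add: lessThan_Suc[of "Suc k", symmetric])
qed

text \<open>The pendant vertex \<open>n - 1\<close> is attached before the path is prolonged beyond \<open>k\<close>.\<close>

lemma anchored_bound_branched:
  fixes n k :: nat
  assumes "Suc k < n"
  shows "anchored_bound (insert (n - 1) {..<Suc k}) (branched_path_adj n k) k
    ((real k + 2) / (real k + 1) - 1 / 2)"
  by (rule anchored_bound_pendant[OF anchored_bound_path])
    (use assms in \<open>auto simp: branched_path_adj_def path_adj_def field_simps\<close>)

text \<open>The vertex \<open>Suc j\<close> lies beyond the branch vertex, so its only neighbour so
  far is \<open>j\<close>.\<close>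

lemma anchored_bound_branched_extend:
  fixes n k :: nat
  assumes "anchored_bound (insert (n - 1) {..<Suc j}) (branched_path_adj n k) j d"
    and "k \<le> j" "d > 1 / 2" "j' = Suc j" "j' < n - 1" "d' = 2 - 1 / d"
  shows "anchored_bound (insert (n - 1) {..<Suc j'}) (branched_path_adj n k) j' d'"
proof -
  have "anchored_bound (insert (Suc j) (insert (n - 1) {..<Suc j})) (branched_path_adj n k) (Suc j) (2 - 1 / d)"
    by (rule anchored_bound_extend[OF assms(1)])
      (use assms in \<open>auto simp: branched_path_adj_def path_adj_def\<close>)
  moreover have "insert (Suc j) (insert (n - 1) {..<Suc j}) = insert (n - 1) {..<Suc (Suc j)}" by auto
  ultimately show ?thesis using assms(4,6) by simp
qed

lemma pos_def_path: "pos_def_on {..<n} path_adj"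
proof (cases n)
  case 0
  then show ?thesis by (simp add: pos_def_on_def)
next
  case (Suc k)
  then show ?thesis using anchored_bound_path[of k path_adj] by (simp add: anchored_bound_def)
qed

lemma pos_def_D:
  assumes "n \<ge> 4"
  shows "pos_def_on {..<n} (branched_path_adj n (n - 3))"
proof -
  \<comment> \<open>The branch vertex becomes \<open>m + 1\<close> and the path ends at
    \<open>m + 2\<close>, one extension later. The bound at the branch is
    \<open>1 / 2 + 1 / (m + 2)\<close>, which exceeds \<open>1 / 2\<close>.\<close>
  obtain m where m: "n = m + 4" using assms by (metis add.commute le_Suc_ex)
  have "anchored_bound (insert (n - 1) {..<Suc (m + 1)}) (branched_path_adj n (m + 1)) (m + 1)
      ((real (m + 1) + 2) / (real (m + 1) + 1) - 1 / 2)"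
    by (rule anchored_bound_branched) (simp add: m)
  then have "anchored_bound (insert (n - 1) {..<Suc (Suc (m + 1))}) (branched_path_adj n (m + 1)) (Suc (m + 1))
      (2 - 1 / ((real (m + 1) + 2) / (real (m + 1) + 1) - 1 / 2))"
    by (rule anchored_bound_branched_extend) (auto simp: m field_simps)
  moreover have "insert (n - 1) {..<Suc (Suc (m + 1))} = {..<n}" by (auto simp: m)
  moreover have "n - 3 = m + 1" by (simp add: m)
  ultimately show ?thesis by (simp add: anchored_bound_def)
qed

lemma pos_def_E:
  assumes "n \<in> {6, 7, 8}"
  shows "pos_def_on {..<n} (branched_path_adj n 2)"
proof -
  let ?ab = "\<lambda>j d. anchored_bound (insert (n - 1) {..<Suc j}) (branched_path_adj n 2) j d"
  \<comment> \<open>The start is \<open>4 / 3 - 1 / 2 = 5 / 6\<close> at the branch vertex;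
    iterating \<open>2 - 1 / d\<close> gives the other constants. At \<open>1 / 2\<close> the
    extension step ceases to apply, so \<open>n = 8\<close> is the last case.\<close>
  have a2: "?ab 2 (5 / 6)" using anchored_bound_branched[of 2 n] assms by force
  have a3: "?ab 3 (4 / 5)"
    by (rule anchored_bound_branched_extend[OF a2]) (use assms in auto)
  have a4: "?ab 4 (3 / 4)"
    by (rule anchored_bound_branched_extend[OF a3]) (use assms in auto)
  have a5: "?ab 5 (2 / 3)" if "n \<ge> 7"
    by (rule anchored_bound_branched_extend[OF a4]) (use that in auto)
  have a6: "?ab 6 (1 / 2)" if "n \<ge> 8"
    by (rule anchored_bound_branched_extend[OF a5]) (use that in auto)
  have *: "insert (n - 1) {..<Suc (n - 2)} = {..<n}" using assms by auto
  consider "n = 6" | "n = 7" | "n = 8" using assms by auto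
  then have "\<exists>d. ?ab (n - 2) d"
    by cases (use a4 a5 a6 in auto)
  then show ?thesis unfolding * by (auto simp: anchored_bound_def)
qed

section \<open>Transport along graph isomorphisms\<close>

lemma cartan_form_bij_betw:
  assumes f: "bij_betw f S T" and adj: "\<forall>i\<in>S. \<forall>j\<in>S. adj i j \<longleftrightarrow> adj' (f i) (f j)"
  shows "cartan_form S adj (\<lambda>i. x (f i)) (\<lambda>i. y (f i)) = cartan_form T adj' x y"
proof -
  have "cartan_form T adj' x y = (\<Sum>i\<in>S. \<Sum>j\<in>S. x (f i) * y (f j) * cartan_entry adj' (f i) (f j))"
    unfolding cartan_form_def by (simp add: sum.reindex_bij_betw[OF f, symmetric])
  also have "\<dots> = cartan_form S adj (\<lambda>i. x (f i)) (\<lambda>i. y (f i))"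
    unfolding cartan_form_def using f adj
    by (intro sum.cong refl) (auto simp: cartan_entry_def bij_betw_def inj_on_eq_iff)
  finally show ?thesis by simp
qed

lemma pos_def_on_graph_iso:
  assumes "graph_iso S adj T adj'" "pos_def_on T adj'"
  shows "pos_def_on S adj"
  unfolding pos_def_on_def
proof (intro allI impI)
  fix x :: "'a \<Rightarrow> int"
  assume x: "\<exists>i\<in>S. x i \<noteq> 0"
  obtain f where f: "bij_betw f S T" and adj: "\<forall>i\<in>S. \<forall>j\<in>S. adj i j \<longleftrightarrow> adj' (f i) (f j)"
    using assms(1) by (auto simp: graph_iso_def)
  let ?y = "\<lambda>j. x (inv_into S f j)"
  have y: "?y (f i) = x i" if "i \<in> S" for i using f that by (simp add: bij_betw_inv_into_left)
  have "\<exists>j\<in>T. ?y j \<noteq> 0" using x y f by (metis bij_betwE)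
  then have "0 < cartan_form T adj' ?y ?y" using assms(2)[unfolded pos_def_on_def, THEN spec, of ?y] by (rule mp[rotated])
  also have "\<dots> = cartan_form S adj (\<lambda>i. ?y (f i)) (\<lambda>i. ?y (f i))"
    by (rule cartan_form_bij_betw[OF f adj, symmetric])
  also have "\<dots> = cartan_form S adj x x" by (rule cartan_form_cong) (simp_all add: y)
  finally show "0 < cartan_form S adj x x" .
qed

section \<open>Roots of a positive definite graph\<close>

locale pos_def_graph =
  fixes I :: "'a set" and adj :: "'a \<Rightarrow> 'a \<Rightarrow> bool"
  assumes finite_vertices: "finite I"
    and adj_sym: "i \<in> I \<Longrightarrow> j \<in> I \<Longrightarrow> adj i j \<Longrightarrow> adj j i"
    and pos_def: "pos_def_on I adj"

lemma simply_laced_dynkin_pos_def_graph: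
  assumes "simply_laced_dynkin I adj"
  shows "pos_def_graph I adj"
proof -
  obtain n adj' where iso: "graph_iso I adj {..<n::nat} adj'" and pd: "pos_def_on {..<n} adj'"
    and sym: "\<And>i j. adj' i j \<Longrightarrow> adj' j i"
  proof -
    have sym: "path_adj i j \<Longrightarrow> path_adj j i" "branched_path_adj n k i j \<Longrightarrow> branched_path_adj n k j i"
      for i j n k by (auto simp: path_adj_def branched_path_adj_def)
    from assms consider n where "graph_iso I adj {..<n} path_adj"
      | n where "n \<ge> 4" "graph_iso I adj {..<n} (branched_path_adj n (n - 3))"
      | n where "n \<in> {6, 7, 8}" "graph_iso I adj {..<n} (branched_path_adj n 2)"
      unfolding simply_laced_dynkin_def by blast
    then show thesis
      by cases (use that sym pos_def_path pos_def_D pos_def_E in metis)+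
  qed
  then obtain f where f: "bij_betw f I {..<n}"
    and fa: "\<forall>i\<in>I. \<forall>j\<in>I. adj i j \<longleftrightarrow> adj' (f i) (f j)"
    by (auto simp: graph_iso_def)
  show ?thesis
  proof
    show "finite I" using bij_betw_finite[OF f] by simp
    show "adj j i" if "i \<in> I" "j \<in> I" "adj i j" for i j using fa sym that by blast
    show "pos_def_on I adj" by (rule pos_def_on_graph_iso[OF iso pd])
  qed
qed

context pos_def_graph
begin

abbreviation B :: "('a \<Rightarrow> int) \<Rightarrow> ('a \<Rightarrow> int) \<Rightarrow> int" where "B \<equiv> cartan_form I adj"
abbreviation \<alpha> :: "'a \<Rightarrow> 'a \<Rightarrow> int" where "\<alpha> \<equiv> simple_root"
abbreviation s :: "'a \<Rightarrow> (('a \<Rightarrow> int) \<Rightarrow> int) \<Rightarrow> ('a \<Rightarrow> int) \<Rightarrow> int"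
  where "s \<equiv> simple_reflection I adj"
abbreviation pos :: "('a \<Rightarrow> int) set" where "pos \<equiv> positive_roots I adj"

text \<open>The action of \<open>s i\<close> on the root lattice; reflecting a coweight amounts to
  evaluating it at the reflected root.\<close>

definition root_reflection :: "'a \<Rightarrow> ('a \<Rightarrow> int) \<Rightarrow> 'a \<Rightarrow> int" where
  "root_reflection i x = (\<lambda>j. x j - B x (\<alpha> i) * \<alpha> i j)"

lemma cartan_entry_sym: "i \<in> I \<Longrightarrow> j \<in> I \<Longrightarrow> cartan_entry adj i j = cartan_entry adj j i"
  using adj_sym by (auto simp: cartan_entry_def)

lemma B_sym: "B x y = B y x"
proof -
  have "B x y = (\<Sum>j\<in>I. \<Sum>i\<in>I. x i * y j * cartan_entry adj i j)"
    unfolding cartan_form_def by (rule sum.swap)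
  also have "\<dots> = B y x"
    unfolding cartan_form_def by (intro sum.cong refl) (simp add: cartan_entry_sym mult.commute)
  finally show ?thesis .
qed

lemma B_linear_left: "B (\<lambda>j. x j - c * y j) z = B x z - c * B y z"
  by (simp add: cartan_form_def sum_distrib_left sum_subtractf algebra_simps)

lemma B_linear_right: "B z (\<lambda>j. x j - c * y j) = B z x - c * B z y"
  using B_linear_left B_sym by metis

lemma B_simple_right:
  assumes "i \<in> I"
  shows "B x (\<alpha> i) = (\<Sum>k\<in>I. x k * cartan_entry adj k i)"
proof -
  have "(\<Sum>j\<in>I. x k * \<alpha> i j * cartan_entry adj k j) = x k * cartan_entry adj k i" for k
  proof -
    have "(\<Sum>j\<in>I. x k * \<alpha> i j * cartan_entry adj k j) = (\<Sum>j\<in>I. if j = i then x k * cartan_entry adj k i else 0)"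
      by (intro sum.cong) (auto simp: simple_root_def)
    then show ?thesis using assms finite_vertices by simp
  qed
  then show ?thesis by (simp add: cartan_form_def)
qed

lemma B_simple_simple: "i \<in> I \<Longrightarrow> j \<in> I \<Longrightarrow> B (\<alpha> i) (\<alpha> j) = cartan_entry adj i j"
  using finite_vertices by (rule cartan_form_simple_root)

lemma B_simple_self: "i \<in> I \<Longrightarrow> B (\<alpha> i) (\<alpha> i) = 2"
  by (simp add: B_simple_simple cartan_entry_def)

lemma B_pos:
  assumes "x \<in> root_lattice I" "x \<noteq> 0"
  shows "0 < B x x"
proof -
  have "\<exists>i\<in>I. x i \<noteq> 0" using assms by (auto simp: root_lattice_def fun_eq_iff)
  then show ?thesis using pos_def unfolding pos_def_on_def by simp
qed

lemma B_even: "even (B x x)"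
  using finite_vertices adj_sym by (rule even_cartan_form)

lemma root_lattice_linear:
  "x \<in> root_lattice I \<Longrightarrow> y \<in> root_lattice I \<Longrightarrow> (\<lambda>j. x j - c * y j) \<in> root_lattice I"
  by (simp add: root_lattice_def)

lemma positive_rootD:
  assumes "b \<in> pos"
  shows "b \<in> root_lattice I" "0 \<le> b i" "B b b = 2"
  using assms by (cases "i \<in> I"; force simp: positive_roots_def root_lattice_def)+

lemma simple_root_pos: "i \<in> I \<Longrightarrow> \<alpha> i \<in> pos"
  by (auto simp: positive_roots_def simple_root_root_lattice B_simple_self) (simp add: simple_root_def)

text \<open>Split \<open>x\<close> into its positive part \<open>p\<close> and negative part
  \<open>q\<close>. Their supports are disjoint, so \<open>B p q \<le> 0\<close>. If both were
  nonzero, each would have norm at least 2 by evenness, making the norm of \<open>x\<close> at least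
  4.\<close>

lemma root_sign:
  assumes x: "x \<in> root_lattice I" "B x x = 2" and j: "0 < x j"
  shows "x \<in> pos"
proof (rule ccontr)
  assume "x \<notin> pos"
  then obtain k where k: "k \<in> I" "x k < 0"
    using x by (auto simp: positive_roots_def not_le)
  define p q where "p = (\<lambda>i. max (x i) 0)" and "q = (\<lambda>i. max (- x i) 0)"
  have xpq: "x = (\<lambda>i. p i - 1 * q i)" by (auto simp: p_def q_def fun_eq_iff)
  have pR: "p \<in> root_lattice I" and qR: "q \<in> root_lattice I"
    using x by (auto simp: root_lattice_def p_def q_def)
  have "B x x = B p p - 2 * B p q + B q q"
    by (subst (1 2) xpq) (simp only: B_linear_left B_linear_right B_sym[of q p], simp)
  moreover have "B p q \<le> 0"
    unfolding cartan_form_def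
    by (intro sum_nonpos) (auto simp: p_def q_def cartan_entry_def mult_le_0_iff)
  moreover have "0 < B p p" using j by (intro B_pos pR) (auto simp: p_def fun_eq_iff intro!: exI[of _ j])
  moreover have "0 < B q q" using k by (intro B_pos qR) (auto simp: q_def fun_eq_iff intro!: exI[of _ k])
  moreover obtain m n where "B p p = 2 * m" "B q q = 2 * n" using B_even by (metis evenE)
  ultimately have "1 \<le> m" "1 \<le> n" "B p q \<le> 0" "2 = 2 * m - 2 * B p q + 2 * n"
    using x(2) by linarith+
  then show False by linarith
qed

text \<open>The sum of two positive roots is nonzero, so its norm \<open>4 + 2 * B b c\<close> is
  positive.\<close>

lemma B_pos_roots_ge:
  assumes "b \<in> pos" "c \<in> pos"
  shows "- 1 \<le> B b c"
proof -
  have sum: "(\<lambda>j. b j - (- 1) * c j) \<in> root_lattice I"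
    using assms by (intro root_lattice_linear positive_rootD)
  obtain i where i: "b i \<noteq> 0"
    using positive_rootD(3)[OF assms(1)] by (fastforce simp: cartan_form_def)
  have "0 < b i + c i"
    using i positive_rootD(2)[OF assms(1), of i] positive_rootD(2)[OF assms(2), of i] by linarith
  then have "(\<lambda>j. b j - (- 1) * c j) \<noteq> 0" by (auto simp: fun_eq_iff intro!: exI[of _ i])
  then have "0 < B (\<lambda>j. b j - (- 1) * c j) (\<lambda>j. b j - (- 1) * c j)" using sum by (rule B_pos[rotated])
  also have "\<dots> = 4 + 2 * B b c"
    unfolding B_linear_left B_linear_right using assms by (simp add: positive_rootD B_sym[of c b])
  finally show ?thesis by simp
qed

text \<open>Two distinct roots cannot agree modulo 3: their difference has norm at most 8, but
  would be three times a nonzero lattice vector, of norm at least 9.\<close>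

lemma finite_pos: "finite pos"
proof (rule finite_imageD)
  let ?r = "\<lambda>x. \<lambda>i. x i mod (3::int)"
  have "?r ` pos \<subseteq> {f. \<forall>i. (i \<in> I \<longrightarrow> f i \<in> {0..2}) \<and> (i \<notin> I \<longrightarrow> f i = 0)}"
    by (auto simp: positive_roots_def root_lattice_def)
  moreover have "finite {f. \<forall>i. (i \<in> I \<longrightarrow> f i \<in> {0..2::int}) \<and> (i \<notin> I \<longrightarrow> f i = 0)}"
    using finite_vertices by (intro finite_set_of_finite_funs) auto
  ultimately show "finite (?r ` pos)" by (rule finite_subset)
  show "inj_on ?r pos"
  proof (rule inj_onI, rule ccontr)
    fix x y assume x: "x \<in> pos" and y: "y \<in> pos" and eq: "?r x = ?r y" and ne: "x \<noteq> y"
    define z where "z = (\<lambda>i. (x i - y i) div 3)"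
    have z: "x i - 1 * y i = 0 - (- 3) * z i" for i
      using fun_cong[OF eq, of i] by (simp add: z_def mod_eq_dvd_iff)
    have "z \<in> root_lattice I"
      using positive_rootD(1)[OF x] positive_rootD(1)[OF y] by (auto simp: z_def root_lattice_def)
    moreover have "z \<noteq> 0"
    proof
      assume "z = 0"
      then have "x i = y i" for i using z[of i] by simp
      then show False using ne by blast
    qed
    ultimately have "0 < B z z" by (rule B_pos)
    have "B (\<lambda>i. x i - 1 * y i) (\<lambda>i. x i - 1 * y i) = 4 - 2 * B x y"
      unfolding B_linear_left B_linear_right using x y by (simp add: positive_rootD B_sym[of y x])
    moreover have "B (\<lambda>i. x i - 1 * y i) (\<lambda>i. x i - 1 * y i) = 9 * B z z"
      unfolding z B_linear_left B_linear_right by (simp add: cartan_form_def)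
    ultimately show False using \<open>0 < B z z\<close> B_pos_roots_ge[OF x y] by simp
  qed
qed

lemma root_reflection_root_lattice:
  "i \<in> I \<Longrightarrow> x \<in> root_lattice I \<Longrightarrow> root_reflection i x \<in> root_lattice I"
  unfolding root_reflection_def by (intro root_lattice_linear simple_root_root_lattice)

lemma B_root_reflection: "i \<in> I \<Longrightarrow> B (root_reflection i x) (root_reflection i x) = B x x"
  unfolding root_reflection_def B_linear_left B_linear_right
  by (simp add: B_simple_self B_sym[of "\<alpha> i" x])

lemma root_reflection_involution: "i \<in> I \<Longrightarrow> root_reflection i (root_reflection i x) = x"
  by (simp add: root_reflection_def B_linear_left B_simple_self)

text \<open>A positive root other than \<open>\<alpha> i\<close> has a positive coordinate at some
  \<open>j \<noteq> i\<close>, since \<open>\<alpha> i\<close> is its only nonnegative multiple of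
  norm 2. The reflection changes only coordinate \<open>i\<close>, so \<open>root_sign\<close>
  applies.\<close>

lemma root_reflection_pos:
  assumes i: "i \<in> I" and b: "b \<in> pos - {\<alpha> i}"
  shows "root_reflection i b \<in> pos - {\<alpha> i}"
proof -
  have bR: "b \<in> root_lattice I" "B b b = 2" and b0: "\<And>j. 0 \<le> b j"
    using b positive_rootD by auto
  have "\<exists>j. j \<noteq> i \<and> b j \<noteq> 0"
  proof (rule ccontr)
    assume "\<not> ?thesis"
    then have bi: "b = (\<lambda>j. 0 - (- b i) * \<alpha> i j)" by (auto simp: fun_eq_iff simple_root_def)
    have "B b b = 2 * (b i * b i)"
      by (subst (1 2) bi, unfold B_linear_left B_linear_right)
        (simp add: B_simple_self[OF i] cartan_form_def[of I adj "\<lambda>_. 0"] cartan_form_def[of I adj _ "\<lambda>_. 0"])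
    then have "b i * b i = 1" using bR by simp
    then have "b i = 1" using b0[of i] by (auto simp: zmult_eq_1_iff)
    then show False using b bi by simp
  qed
  then obtain j where j: "j \<noteq> i" "0 < b j" using b0 by (metis order_le_imp_less_or_eq)
  then have "0 < root_reflection i b j" by (simp add: root_reflection_def simple_root_def)
  then have "root_reflection i b \<in> pos"
    using i bR by (intro root_sign root_reflection_root_lattice) (simp_all add: B_root_reflection)
  moreover have "root_reflection i b \<noteq> \<alpha> i"
  proof
    assume "root_reflection i b = \<alpha> i"
    then have "root_reflection i b j = 0" using j by (simp add: simple_root_def)
    then show False using \<open>0 < root_reflection i b j\<close> by simp
  qed
  ultimately show ?thesis by simp
qed

section \<open>Reflecting coweights\<close>

lemma coweight_sum:
  assumes "l \<in> coweights I" "x \<in> root_lattice I"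
  shows "l x = (\<Sum>i\<in>I. x i * l (\<alpha> i))"
proof -
  let ?m = "\<lambda>x. if x \<in> root_lattice I then \<Sum>i\<in>I. x i * l (\<alpha> i) else 0"
  have "l = ?m"
  proof (rule coweights_eqI[OF finite_vertices assms(1)])
    show "?m \<in> coweights I"
      by (auto simp: coweights_def root_lattice_add sum.distrib distrib_right)
    fix i assume i: "i \<in> I"
    have "(\<Sum>j\<in>I. \<alpha> i j * l (\<alpha> j)) = (\<Sum>j\<in>I. if j = i then l (\<alpha> i) else 0)"
      by (intro sum.cong) (auto simp: simple_root_def)
    then show "l (\<alpha> i) = ?m (\<alpha> i)" using i finite_vertices by (simp add: simple_root_root_lattice)
  qed
  then show ?thesis using assms(2) by metis
qed

lemma coweight_linear:
  assumes "l \<in> coweights I" "x \<in> root_lattice I" "y \<in> root_lattice I"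
  shows "l (\<lambda>j. x j - c * y j) = l x - c * l y"
  using assms
  by (simp add: coweight_sum root_lattice_linear sum_subtractf sum_distrib_left algebra_simps)

lemma s_coweights: "i \<in> I \<Longrightarrow> l \<in> coweights I \<Longrightarrow> s i l \<in> coweights I"
  using simple_reflection_Bij[OF finite_vertices, of i adj] by (auto simp: Bij_def bij_betw_def)

lemma s_apply:
  "l \<in> coweights I \<Longrightarrow> x \<in> root_lattice I \<Longrightarrow> s i l x = l x - l (\<alpha> i) * B x (\<alpha> i)"
  by (simp add: simple_reflection_def coroot_def)

lemma s_simple:
  "i \<in> I \<Longrightarrow> j \<in> I \<Longrightarrow> l \<in> coweights I \<Longrightarrow> s i l (\<alpha> j) = l (\<alpha> j) - l (\<alpha> i) * cartan_entry adj j i"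
  by (simp add: s_apply simple_root_root_lattice B_simple_simple)

lemma s_root_reflection:
  "i \<in> I \<Longrightarrow> l \<in> coweights I \<Longrightarrow> x \<in> root_lattice I \<Longrightarrow> s i l x = l (root_reflection i x)"
  by (simp add: s_apply root_reflection_def coweight_linear[where y = "\<alpha> i"] simple_root_root_lattice)

section \<open>Counting negative pairings\<close>

definition neg_count :: "(('a \<Rightarrow> int) \<Rightarrow> int) \<Rightarrow> nat" where
  "neg_count l = card {b \<in> pos. l b < 0}"

lemma neg_count_split:
  assumes "i \<in> I"
  shows "neg_count l = card {b \<in> pos - {\<alpha> i}. l b < 0} + (if l (\<alpha> i) < 0 then 1 else 0)"
proof (cases "l (\<alpha> i) < 0")
  case True
  then have "{b \<in> pos. l b < 0} = insert (\<alpha> i) {b \<in> pos - {\<alpha> i}. l b < 0}"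
    using simple_root_pos[OF assms] by auto
  then show ?thesis using True finite_pos by (simp add: neg_count_def)
next
  case False
  then have "{b \<in> pos. l b < 0} = {b \<in> pos - {\<alpha> i}. l b < 0}" by auto
  then show ?thesis using False by (simp add: neg_count_def)
qed

text \<open>Away from \<open>\<alpha> i\<close>, \<open>root_reflection i\<close> matches the
  positive roots on which \<open>s i l\<close> is negative with those on which \<open>l\<close> is.
  At \<open>\<alpha> i\<close> the pairing changes sign, and only this root alters the
  count.\<close>

lemma neg_count_s:
  assumes i: "i \<in> I" and l: "l \<in> coweights I"
  shows "neg_count l \<le> Suc (neg_count (s i l))"
    and "l (\<alpha> i) < 0 \<Longrightarrow> neg_count l = Suc (neg_count (s i l))"
proof -
  have "bij_betw (root_reflection i) {b \<in> pos - {\<alpha> i}. s i l b < 0} {b \<in> pos - {\<alpha> i}. l b < 0}"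
  proof (rule bij_betw_byWitness[where f' = "root_reflection i"])
    have s_eq: "s i l b = l (root_reflection i b)" if "b \<in> pos - {\<alpha> i}" for b
      using i l that by (simp add: s_root_reflection positive_rootD(1))
    show "root_reflection i ` {b \<in> pos - {\<alpha> i}. s i l b < 0} \<subseteq> {b \<in> pos - {\<alpha> i}. l b < 0}"
    proof (intro image_subsetI CollectI conjI; elim CollectE conjE)
      fix b assume b: "b \<in> pos - {\<alpha> i}" "s i l b < 0"
      show "root_reflection i b \<in> pos - {\<alpha> i}" using i b(1) by (rule root_reflection_pos)
      show "l (root_reflection i b) < 0" using b by (simp only: s_eq)
    qed
    show "root_reflection i ` {b \<in> pos - {\<alpha> i}. l b < 0} \<subseteq> {b \<in> pos - {\<alpha> i}. s i l b < 0}"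
    proof (intro image_subsetI CollectI conjI; elim CollectE conjE)
      fix b assume b: "b \<in> pos - {\<alpha> i}" "l b < 0"
      show rb: "root_reflection i b \<in> pos - {\<alpha> i}" using i b(1) by (rule root_reflection_pos)
      show "s i l (root_reflection i b) < 0"
        using b(2) by (simp only: s_eq[OF rb] root_reflection_involution[OF i])
    qed
  qed (use i in \<open>simp_all add: root_reflection_involution\<close>)
  then have card: "card {b \<in> pos - {\<alpha> i}. s i l b < 0} = card {b \<in> pos - {\<alpha> i}. l b < 0}"
    by (rule bij_betw_same_card)
  have "s i l (\<alpha> i) = - l (\<alpha> i)"
    using i l by (simp add: s_simple cartan_entry_def)
  then show "neg_count l \<le> Suc (neg_count (s i l))"
    and "l (\<alpha> i) < 0 \<Longrightarrow> neg_count l = Suc (neg_count (s i l))"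
    using neg_count_split[OF i, of l] neg_count_split[OF i, of "s i l"] card by auto
qed

section \<open>Words\<close>

lemma word_prod_Bij: "is \<in> lists I \<Longrightarrow> word_prod I adj is \<in> Bij (coweights I)"
proof (induction "is")
  case Nil
  then show ?case by (simp add: word_prod_def BijGroup_def id_Bij del: restrict_apply)
next
  case (Cons i "is")
  then show ?case
    using compose_Bij[OF simple_reflection_Bij[OF finite_vertices, of i adj], of "word_prod I adj is"]
      simple_reflection_Bij[OF finite_vertices, of i adj]
    by (simp add: word_prod_def BijGroup_def)
qed

lemma word_prod_Nil_apply: "l \<in> coweights I \<Longrightarrow> word_prod I adj [] l = l"
  by (simp add: word_prod_def BijGroup_def)

lemma word_prod_Cons_apply:
  assumes "i \<in> I" "is \<in> lists I" "l \<in> coweights I"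
  shows "word_prod I adj (i # is) l = s i (word_prod I adj is l)"
  using assms word_prod_Bij[of "is"] simple_reflection_Bij[OF finite_vertices, of i adj]
  by (simp add: word_prod_def BijGroup_def compose_def)

lemma word_prod_coweights: "is \<in> lists I \<Longrightarrow> l \<in> coweights I \<Longrightarrow> word_prod I adj is l \<in> coweights I"
  using word_prod_Bij[of "is"] by (auto simp: Bij_def bij_betw_def)

text \<open>The last letter acts first; peeling it off exposes the first move made from
  \<open>l\<close>.\<close>

lemma word_prod_snoc_apply:
  assumes "i \<in> I" "is \<in> lists I" "l \<in> coweights I"
  shows "word_prod I adj (is @ [i]) l = word_prod I adj is (s i l)"
  using assms(2)
proof (induction "is")
  case Nil
  then show ?case using assms by (simp add: word_prod_Cons_apply word_prod_Nil_apply s_coweights)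
next
  case (Cons j "is")
  then show ?case using assms by (simp add: word_prod_Cons_apply s_coweights)
qed

lemma word_prod_weyl_group: "is \<in> lists I \<Longrightarrow> word_prod I adj is \<in> weyl_group I adj"
proof (induction "is")
  case Nil
  then show ?case by (simp add: word_prod_def weyl_group_def generate.one)
next
  case (Cons i "is")
  have "word_prod I adj (i # is) = s i \<otimes>\<^bsub>BijGroup (coweights I)\<^esub> word_prod I adj is"
    by (simp add: word_prod_def)
  moreover have "s i \<in> weyl_group I adj"
    using Cons.prems by (simp add: weyl_group_def generate.incl)
  ultimately show ?case using Cons by (simp add: weyl_group_def generate.eng)
qed

text \<open>These are the admissible words, played from right to left: moves of the numbers game of
  Mozes at vertices whose current value is -1.\<close>

fun firing :: "(('a \<Rightarrow> int) \<Rightarrow> int) \<Rightarrow> 'a list \<Rightarrow> bool" where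
  "firing l [] \<longleftrightarrow> True"
| "firing l (i # is) \<longleftrightarrow> firing l is \<and> word_prod I adj is l (\<alpha> i) = - 1"

text \<open>Once the shorter suffix has the right sum, the next reflection subtracts the current
  pairing with \<open>\<alpha> i\<close> times the coroot. As the coroot is nonzero at
  \<open>\<alpha> i\<close>, this adds it exactly once if and only if the pairing is -1.\<close>

lemma firing_iff_sums:
  assumes "is \<in> lists I" "l \<in> coweights I"
  shows "(\<forall>r<length is. word_prod I adj (drop r is) l =
      l + (\<Sum>i\<leftarrow>drop r is. coroot I adj (\<alpha> i))) \<longleftrightarrow> firing l is"
  using assms(1)
proof (induction "is")
  case Nil
  then show ?case by simp
next
  case (Cons i "is")
  let ?sum = "\<lambda>js. l + (\<Sum>i\<leftarrow>js. coroot I adj (\<alpha> i))"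
  let ?\<mu> = "word_prod I adj is l"
  have i: "i \<in> I" and "is": "is \<in> lists I" using Cons.hyps by auto
  have IH: "(\<forall>r<length is. word_prod I adj (drop r is) l = ?sum (drop r is)) \<longleftrightarrow> firing l is"
    by (rule Cons.IH)
  have \<mu>: "?\<mu> \<in> coweights I" using "is" assms(2) by (rule word_prod_coweights)
  have step: "word_prod I adj (i # is) l = ?sum (i # is) \<longleftrightarrow> ?\<mu> (\<alpha> i) = - 1" if "firing l is"
  proof -
    have eq: "?\<mu> = ?sum is"
    \<comment> \<open>The indices \<open>r < length is\<close> leave out the empty suffix, so the
      empty word is treated separately.\<close>
    proof (cases "is")
      case Nil
      then show ?thesis using assms(2) by (simp add: word_prod_Nil_apply)
    next
      case (Cons j js)
      then have "word_prod I adj (drop 0 is) l = ?sum (drop 0 is)" using IH that by blast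
      then show ?thesis by simp
    qed
    have lhs: "word_prod I adj (i # is) l = (\<lambda>x. ?\<mu> x - ?\<mu> (\<alpha> i) * coroot I adj (\<alpha> i) x)"
      using i "is" assms(2) \<mu> by (simp add: word_prod_Cons_apply simple_reflection_def)
    have rhs: "?sum (i # is) = (\<lambda>x. ?\<mu> x + coroot I adj (\<alpha> i) x)"
      by (simp add: eq fun_eq_iff)
    have "coroot I adj (\<alpha> i) (\<alpha> i) = 2"
      using i by (simp add: coroot_def simple_root_root_lattice B_simple_self)
    moreover have "word_prod I adj (i # is) l = ?sum (i # is) \<longleftrightarrow>
        (\<forall>x. - ?\<mu> (\<alpha> i) * coroot I adj (\<alpha> i) x = coroot I adj (\<alpha> i) x)"
      unfolding lhs rhs fun_eq_iff by simp
    ultimately show ?thesis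
      by (auto dest!: spec[of _ "\<alpha> i"])
  qed
  have "(\<forall>r<length (i # is). word_prod I adj (drop r (i # is)) l = ?sum (drop r (i # is))) \<longleftrightarrow>
      word_prod I adj (i # is) l = ?sum (i # is) \<and>
      (\<forall>r<length is. word_prod I adj (drop r is) l = ?sum (drop r is))"
    unfolding length_Cons All_less_Suc2 by simp
  then show ?case using IH step by auto
qed

lemma firing_snoc:
  assumes "i \<in> I" "is \<in> lists I" "l \<in> coweights I"
  shows "firing l (is @ [i]) \<longleftrightarrow> l (\<alpha> i) = - 1 \<and> firing (s i l) is"
  using assms(2)
  by (induction "is") (use assms in \<open>auto simp: word_prod_Nil_apply word_prod_snoc_apply\<close>)

lemma neg_count_word_prod:
  assumes "l \<in> coweights I" "is \<in> lists I"
  shows "neg_count l \<le> neg_count (word_prod I adj is l) + length is"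
  using assms(2)
proof (induction "is")
  case Nil
  then show ?case using assms by (simp add: word_prod_Nil_apply)
next
  case (Cons i "is")
  then show ?case
    using neg_count_s(1)[of i "word_prod I adj is l"] assms
    by (simp add: word_prod_Cons_apply word_prod_coweights)
qed

lemma neg_count_firing:
  assumes "l \<in> coweights I" "is \<in> lists I" "firing l is"
  shows "neg_count l = neg_count (word_prod I adj is l) + length is"
  using assms(2,3)
proof (induction "is")
  case Nil
  then show ?case using assms by (simp add: word_prod_Nil_apply)
next
  case (Cons i "is")
  then show ?case
    using neg_count_s(2)[of i "word_prod I adj is l"] assms
    by (simp add: word_prod_Cons_apply word_prod_coweights)
qed

text \<open>Reducedness is automatic: a word with the same product takes \<open>l\<close> to the
  same coweight, so it has at least as many letters as \<open>neg_count\<close> drops, and a firing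
  word has exactly that many.\<close>

lemma minuscule_dominant_iff:
  assumes l: "l \<in> coweights I"
  shows "(\<exists>w\<in>weyl_group I adj. minuscule I adj l w \<and> dominant I (w l)) \<longleftrightarrow>
    (\<exists>is\<in>lists I. firing l is \<and> dominant I (word_prod I adj is l))"
proof
  assume "\<exists>w\<in>weyl_group I adj. minuscule I adj l w \<and> dominant I (w l)"
  then show "\<exists>is\<in>lists I. firing l is \<and> dominant I (word_prod I adj is l)"
    using firing_iff_sums[OF _ l] unfolding minuscule_def reduced_expression_def by blast
next
  assume "\<exists>is\<in>lists I. firing l is \<and> dominant I (word_prod I adj is l)"
  then obtain "is" where "is": "is \<in> lists I" "firing l is" "dominant I (word_prod I adj is l)" by blast
  have "length is \<le> length js" if "js \<in> lists I" "word_prod I adj js = word_prod I adj is" for js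
    using neg_count_word_prod[OF l that(1)] neg_count_firing[OF l "is"(1,2)] that(2) by simp
  then have "minuscule I adj l (word_prod I adj is)"
    unfolding minuscule_def reduced_expression_def using "is" firing_iff_sums[OF "is"(1) l] by blast
  then show "\<exists>w\<in>weyl_group I adj. minuscule I adj l w \<and> dominant I (w l)"
    using "is" word_prod_weyl_group by blast
qed

section \<open>The obstruction\<close>

lemma dominant_nonneg_pos:
  assumes "l \<in> coweights I" "dominant I l" "b \<in> pos"
  shows "0 \<le> l b"
  using assms by (auto simp: coweight_sum positive_rootD dominant_def intro!: sum_nonneg)

text \<open>Induction from the first move, with \<open>b\<close> varying: for
  \<open>b \<noteq> \<alpha> i\<close> the value \<open>l b\<close> is that of \<open>s i l\<close>
  at the positive root \<open>root_reflection i b\<close>, while at \<open>\<alpha> i\<close> it is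
  -1 by admissibility.\<close>

lemma firing_dominant_ge:
  assumes "is \<in> lists I" "l \<in> coweights I" "firing l is" "dominant I (word_prod I adj is l)" "b \<in> pos"
  shows "- 1 \<le> l b"
  using assms
proof (induction "is" arbitrary: l b rule: rev_induct)
  case Nil
  then show ?case using dominant_nonneg_pos[of l b] by (simp add: word_prod_Nil_apply)
next
  case (snoc i "is")
  have i: "i \<in> I" and "is": "is \<in> lists I" using snoc.prems by auto
  have li: "l (\<alpha> i) = - 1" and f: "firing (s i l) is"
    using firing_snoc[OF i "is" snoc.prems(2)] snoc.prems(3) by auto
  show ?case
  proof (cases "b = \<alpha> i")
    case True
    then show ?thesis using li by simp
  next
    case False
    then have rb: "root_reflection i b \<in> pos" using root_reflection_pos[OF i, of b] snoc.prems by simp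
    have "- 1 \<le> s i l (root_reflection i b)"
      using snoc.prems(4) by (intro snoc.IH "is" s_coweights f rb i snoc.prems(2))
        (simp add: word_prod_snoc_apply[OF i "is" snoc.prems(2)])
    then show ?thesis
      using i snoc.prems by (simp add: s_root_reflection root_reflection_root_lattice positive_rootD(1) root_reflection_involution)
  qed
qed

text \<open>A violation of condition (ii) phrased inside \<open>I\<close>: the subdiagram is the
  support of \<open>b\<close>, and the equations say that \<open>l\<close> restricts there to the
  negative coroot of \<open>b\<close>. One form \<open>B\<close> thus serves all
  subdiagrams.\<close>

definition obstructed :: "(('a \<Rightarrow> int) \<Rightarrow> int) \<Rightarrow> bool" where
  "obstructed l \<longleftrightarrow> (\<exists>b\<in>pos. connected_subdiagram I adj {i. b i \<noteq> 0} \<and>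
     (\<forall>i. b i \<noteq> 0 \<longrightarrow> l (\<alpha> i) = - B b (\<alpha> i)))"

lemma obstructed_minus_two:
  assumes "i \<in> I" "l (\<alpha> i) = - 2"
  shows "obstructed l"
proof -
  have "{j. \<alpha> i j \<noteq> 0} = {i}" by (auto simp: simple_root_def)
  then have "connected_subdiagram I adj {j. \<alpha> i j \<noteq> 0}" using assms by (simp add: connected_subdiagram_def)
  moreover have "\<forall>j. \<alpha> i j \<noteq> 0 \<longrightarrow> l (\<alpha> j) = - B (\<alpha> i) (\<alpha> j)"
  proof (intro allI impI)
    fix j assume "\<alpha> i j \<noteq> 0"
    then have "j = i" by (simp add: simple_root_def split: if_splits)
    then show "l (\<alpha> j) = - B (\<alpha> i) (\<alpha> j)" using assms by (simp add: B_simple_self)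
  qed
  ultimately show ?thesis unfolding obstructed_def using simple_root_pos[OF assms(1)] by blast
qed

lemma connected_subdiagram_insert:
  assumes conn: "connected_subdiagram I adj S" and j: "j \<in> I" and k: "k \<in> S" "adj j k"
  shows "connected_subdiagram I adj (insert j S)"
proof -
  let ?r = "{(x, y). x \<in> S \<and> y \<in> S \<and> adj x y}"
  let ?R = "{(x, y). x \<in> insert j S \<and> y \<in> insert j S \<and> adj x y}"
  have S: "S \<subseteq> I" "S \<noteq> {}" and c: "\<And>x y. x \<in> S \<Longrightarrow> y \<in> S \<Longrightarrow> (x, y) \<in> ?r\<^sup>*"
    using conn unfolding connected_subdiagram_def by blast+
  have "?r \<subseteq> ?R" by auto
  then have c: "(x, y) \<in> ?R\<^sup>*" if "x \<in> S" "y \<in> S" for x y using c[OF that] rtrancl_mono by blast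
  have "adj k j" using adj_sym j k S by blast
  then have jk: "(j, k) \<in> ?R\<^sup>*" "(k, j) \<in> ?R\<^sup>*" using k by auto
  have to_k: "(x, k) \<in> ?R\<^sup>*" "(k, x) \<in> ?R\<^sup>*" if "x \<in> insert j S" for x
    using that jk c k(1) by auto
  have "(x, y) \<in> ?R\<^sup>*" if "x \<in> insert j S" "y \<in> insert j S" for x y
    using to_k(1)[OF that(1)] to_k(2)[OF that(2)] by (rule rtrancl_trans)
  then show ?thesis unfolding connected_subdiagram_def using S j by blast
qed

text \<open>If \<open>s\<^sub>j \<lambda>\<close> is obstructed by \<open>b\<close>, then \<open>\<lambda>\<close> is obstructed by \<open>s\<^sub>j b\<close>, which is \<open>b + \<alpha>\<^sub>j\<close> or \<open>b\<close>.\<close>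

lemma obstructed_backwards:
  assumes l: "l \<in> coweights I" and j: "j \<in> I" "l (\<alpha> j) = - 1" and obs: "obstructed (s j l)"
  shows "obstructed l"
proof -
  obtain b where b: "b \<in> pos" and conn: "connected_subdiagram I adj {i. b i \<noteq> 0}"
    and eq: "\<And>i. b i \<noteq> 0 \<Longrightarrow> s j l (\<alpha> i) = - B b (\<alpha> i)"
    using obs unfolding obstructed_def by blast
  have supp: "i \<in> I" if "b i \<noteq> 0" for i
    using positive_rootD(1)[OF b] that by (auto simp: root_lattice_def)
  have b0: "0 \<le> b i" for i using b by (rule positive_rootD)
  have eq': "l (\<alpha> i) = - B b (\<alpha> i) - cartan_entry adj i j" if "b i \<noteq> 0" for i
    using eq[OF that] s_simple[OF j(1) supp[OF that] l] j(2) by simp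
  have jb: "B b (\<alpha> j) = - 1" if "b j \<noteq> 0"
    using eq'[OF that] j(2) by (simp add: cartan_entry_def)
  have ge: "- 1 \<le> B b (\<alpha> j)" using b simple_root_pos[OF j(1)] by (rule B_pos_roots_ge)
  have term_nonpos: "b k * cartan_entry adj k j \<le> 0" if "b j = 0" for k
    using that b0[of k] by (auto simp: cartan_entry_def)
  have Bbj: "B b (\<alpha> j) = (\<Sum>k\<in>I. b k * cartan_entry adj k j)" using j(1) by (rule B_simple_right)
  have le: "B b (\<alpha> j) \<le> 0" if "b j = 0" unfolding Bbj using term_nonpos[OF that] by (rule sum_nonpos)
  \<comment> \<open>If \<open>b j = 0\<close>, all terms of \<open>B b (\<alpha> j)\<close> are
    nonpositive and their sum is at least -1; if \<open>b j \<noteq> 0\<close>, the obstruction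
    equation at \<open>j\<close> forces -1.\<close>
  consider "B b (\<alpha> j) = 0" "b j = 0" | "B b (\<alpha> j) = - 1"
    using jb ge le by fastforce
  then show ?thesis
  proof cases
    case 1
    \<comment> \<open>A vanishing sum of nonpositive terms: \<open>j\<close> has no neighbour in the
      support of \<open>b\<close>, so the move at \<open>j\<close> leaves the values there
      unchanged.\<close>
    have "b k * cartan_entry adj k j = 0" if "k \<in> I" for k
    proof -
      have "(\<Sum>k\<in>I. - (b k * cartan_entry adj k j)) = 0" using 1 Bbj by (simp add: sum_negf)
      then show ?thesis
        using term_nonpos[OF 1(2)] finite_vertices that by (subst (asm) sum_nonneg_eq_0_iff) auto
    qed
    then have "cartan_entry adj i j = 0" if "b i \<noteq> 0" for i using that supp by fastforce
    then have "l (\<alpha> i) = - B b (\<alpha> i)" if "b i \<noteq> 0" for i using eq' that by simp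
    then show ?thesis unfolding obstructed_def using b conn by blast
  next
    case 2
    define c where "c = root_reflection j b"
    have c_def': "c = (\<lambda>k. b k - (- 1) * \<alpha> j k)" by (simp add: c_def root_reflection_def 2)
    have "b \<noteq> \<alpha> j" using 2 B_simple_self[OF j(1)] by auto
    then have c: "c \<in> pos" unfolding c_def using root_reflection_pos[OF j(1), of b] b by simp
    have supp_c: "{i. c i \<noteq> 0} = insert j {i. b i \<noteq> 0}"
      using b0[of j] by (auto simp: c_def' simple_root_def)
    \<comment> \<open>Adding \<open>\<alpha> j\<close> to \<open>b\<close> shifts the pairing by the
      very Cartan entry that appears as a correction in \<open>eq'\<close>, so the obstruction
      equations hold for \<open>c\<close>.\<close>
    have Bc: "B c (\<alpha> i) = B b (\<alpha> i) + cartan_entry adj i j" if "i \<in> I" for i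
      unfolding c_def' B_linear_left using that j(1) by (simp add: B_simple_simple cartan_entry_sym)
    have "l (\<alpha> i) = - B c (\<alpha> i)" if "c i \<noteq> 0" for i
    proof (cases "b i = 0")
      case True
      then have "i = j" using that supp_c by blast
      then show ?thesis using j Bc[OF j(1)] 2 by (simp add: cartan_entry_def)
    next
      case False
      then show ?thesis using eq' Bc[OF supp] by simp
    qed
    moreover have "connected_subdiagram I adj (insert j {i. b i \<noteq> 0})"
    proof (cases "b j = 0")
      case True
      \<comment> \<open>As \<open>B b (\<alpha> j)\<close> is nonzero, \<open>j\<close> has a
        neighbour in the support, so adjoining \<open>j\<close> keeps it connected.\<close>
      have "\<exists>k\<in>I. b k * cartan_entry adj k j \<noteq> 0"
      proof (rule ccontr)
        assume "\<not> ?thesis"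
        then have "(\<Sum>k\<in>I. b k * cartan_entry adj k j) = 0" by (intro sum.neutral) blast
        then show False using Bbj 2 by simp
      qed
      then obtain k where k: "k \<in> I" "b k \<noteq> 0" "cartan_entry adj k j \<noteq> 0" by auto
      then have "adj k j" using True by (auto simp: cartan_entry_def split: if_splits)
      then show ?thesis
        using k j(1) conn adj_sym by (intro connected_subdiagram_insert[of _ j k]) auto
    next
      case False
      then show ?thesis using conn by (simp add: insert_absorb)
    qed
    ultimately show ?thesis unfolding obstructed_def using c supp_c by metis
  qed
qed

lemma unobstructed_firing:
  assumes "l \<in> coweights I" "\<forall>i\<in>I. - 1 \<le> l (\<alpha> i)" "\<not> obstructed l"
  shows "\<exists>is\<in>lists I. firing l is \<and> dominant I (word_prod I adj is l)"
  using assms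
proof (induction "neg_count l" arbitrary: l rule: less_induct)
  case less
  note l = less.prems(1)
  show ?case
  proof (cases "dominant I l")
    case True
    then show ?thesis using l by (intro bexI[of _ "[]"]) (auto simp: word_prod_Nil_apply)
  next
    case False
    then obtain i where i: "i \<in> I" and "l (\<alpha> i) < 0" by (auto simp: dominant_def)
    then have li: "l (\<alpha> i) = - 1" using less.prems(2) by force
    have no: "\<not> obstructed (s i l)" using obstructed_backwards[OF l i li] less.prems(3) by blast
    have "- 1 \<le> s i l (\<alpha> j)" if j: "j \<in> I" for j
    proof -
      \<comment> \<open>The move adds 2 at \<open>i\<close> and subtracts at most 1 elsewhere, so a
        value can drop below -1 only to -2; that would be an obstruction supported at one
        vertex.\<close>
      have "- 2 \<le> s i l (\<alpha> j)"
        using less.prems(2) j li by (auto simp: s_simple[OF i j l] cartan_entry_def)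
      moreover have "s i l (\<alpha> j) \<noteq> - 2" using obstructed_minus_two[OF j] no by blast
      ultimately show ?thesis by simp
    qed
    moreover have "neg_count (s i l) < neg_count l" using neg_count_s(2)[OF i l] li by simp
    ultimately obtain "is" where "is": "is \<in> lists I" "firing (s i l) is"
        "dominant I (word_prod I adj is (s i l))"
      using less.hyps[of "s i l"] no s_coweights[OF i l] by blast
    then have "firing l (is @ [i])" "dominant I (word_prod I adj (is @ [i]) l)"
      using i l li by (simp_all add: firing_snoc word_prod_snoc_apply)
    moreover have "is @ [i] \<in> lists I" using "is" i by simp
    ultimately show ?thesis by blast
  qed
qed

section \<open>Restrictions to subdiagrams\<close>

lemma cartan_form_subset:
  assumes "S \<subseteq> I" "x \<in> root_lattice S" "y \<in> root_lattice S"
  shows "cartan_form S adj x y = B x y"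
proof -
  have "(\<Sum>j\<in>S. x i * y j * cartan_entry adj i j) = (\<Sum>j\<in>I. x i * y j * cartan_entry adj i j)" for i
    using assms finite_vertices by (intro sum.mono_neutral_left) (auto simp: root_lattice_def)
  then show ?thesis
    unfolding cartan_form_def
    using assms finite_vertices by (auto intro!: sum.mono_neutral_left simp: root_lattice_def)
qed

text \<open>A positive root \<open>a\<close> of \<open>S\<close> is also one of \<open>I\<close>,
  and evaluating the forbidden equality at \<open>a\<close> itself would give
  \<open>l a = - 2\<close>.\<close>

lemma restrict_ne_if_ge:
  assumes l: "l \<in> coweights I" and ge: "\<And>b. b \<in> pos \<Longrightarrow> - 1 \<le> l b"
    and S: "S \<subseteq> I" and a: "a \<in> positive_roots S adj"
  shows "restrict_coweight S l \<noteq> - coroot S adj a"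
proof
  assume "restrict_coweight S l = - coroot S adj a"
  then have "restrict_coweight S l a = (- coroot S adj a) a" by simp
  moreover have aS: "a \<in> root_lattice S" "cartan_form S adj a a = 2" and a0: "\<forall>i\<in>S. 0 \<le> a i"
    using a by (auto simp: positive_roots_def)
  ultimately have "l a = - 2"
    by (simp add: restrict_coweight_eq[OF finite_vertices S l] coroot_def)
  moreover have "a \<in> root_lattice I" using aS S by (auto simp: root_lattice_def)
  moreover have "\<forall>i. 0 \<le> a i"
  proof
    show "0 \<le> a i" for i using a0 aS(1) by (cases "i \<in> S") (simp_all add: root_lattice_def)
  qed
  ultimately show False
    using ge[of a] cartan_form_subset[OF S aS(1) aS(1)] aS(2) by (simp add: positive_roots_def)
qed

text \<open>Take \<open>S\<close> to be the support of the obstructing root. Coweights of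
  \<open>S\<close> are determined by their values on simple roots, so the obstruction equations give
  the whole identity.\<close>

lemma restrict_eq_if_obstructed:
  assumes l: "l \<in> coweights I" and obs: "obstructed l"
  shows "\<exists>S. connected_subdiagram I adj S \<and>
    (\<exists>a\<in>positive_roots S adj. restrict_coweight S l = - coroot S adj a)"
proof -
  obtain b where b: "b \<in> pos" and conn: "connected_subdiagram I adj {i. b i \<noteq> 0}"
    and eq: "\<And>i. b i \<noteq> 0 \<Longrightarrow> l (\<alpha> i) = - B b (\<alpha> i)"
    using obs unfolding obstructed_def by blast
  define S where "S = {i. b i \<noteq> 0}"
  have S: "S \<subseteq> I" using conn by (simp add: connected_subdiagram_def S_def)
  have bS: "b \<in> root_lattice S" by (simp add: root_lattice_def S_def)
  have "b \<in> positive_roots S adj"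
    using bS positive_rootD(2,3)[OF b] cartan_form_subset[OF S bS bS] by (simp add: positive_roots_def)
  moreover have "restrict_coweight S l = - coroot S adj b"
  proof (rule coweights_eqI)
    show "finite S" using S finite_vertices by (rule finite_subset)
    show "restrict_coweight S l \<in> coweights S"
    proof -
      have "root_lattice S \<subseteq> root_lattice I" using S by (auto simp: root_lattice_def)
      then show ?thesis
        unfolding restrict_coweight_eq[OF finite_vertices S l]
        using l by (simp add: coweights_def root_lattice_add subset_iff)
    qed
    show "- coroot S adj b \<in> coweights S"
      using coroot_coweights[of S adj b] by (simp add: coweights_def)
    fix i assume i: "i \<in> S"
    then have iS: "\<alpha> i \<in> root_lattice S" by (rule simple_root_root_lattice)
    have "l (\<alpha> i) = - B (\<alpha> i) b" using eq[of i] i B_sym[of b "\<alpha> i"] by (simp add: S_def)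
    then show "restrict_coweight S l (\<alpha> i) = (- coroot S adj b) (\<alpha> i)"
      using iS by (simp add: restrict_coweight_eq[OF finite_vertices S l] coroot_def
          cartan_form_subset[OF S iS bS])
  qed
  ultimately show ?thesis using conn unfolding S_def by blast
qed

end

theorem theorem1p4:
  fixes I :: "'a set" and adj :: "'a \<Rightarrow> 'a \<Rightarrow> bool" and l :: "('a \<Rightarrow> int) \<Rightarrow> int"
  assumes "simply_laced_dynkin I adj"
    and "l \<in> coweights I"
  shows "(\<exists>w\<in>weyl_group I adj. minuscule I adj l w \<and> dominant I (w l)) \<longleftrightarrow>
    ((\<forall>i\<in>I. l (simple_root i) \<ge> -1) \<and>
     (\<forall>S. connected_subdiagram I adj S \<longrightarrow>
        (\<forall>a\<in>positive_roots S adj. restrict_coweight S l \<noteq> - coroot S adj a)))"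
proof -
  interpret pos_def_graph I adj using assms(1) by (rule simply_laced_dynkin_pos_def_graph)
  show ?thesis
    unfolding minuscule_dominant_iff[OF assms(2)]
  proof
    assume "\<exists>is\<in>lists I. firing l is \<and> dominant I (word_prod I adj is l)"
    then have ge: "- 1 \<le> l b" if "b \<in> pos" for b
      using firing_dominant_ge[OF _ assms(2)] that by blast
    show "(\<forall>i\<in>I. l (simple_root i) \<ge> -1) \<and>
     (\<forall>S. connected_subdiagram I adj S \<longrightarrow>
        (\<forall>a\<in>positive_roots S adj. restrict_coweight S l \<noteq> - coroot S adj a))"
      using ge simple_root_pos restrict_ne_if_ge[OF assms(2) ge]
      by (auto simp: connected_subdiagram_def)
  next
    assume "(\<forall>i\<in>I. l (simple_root i) \<ge> -1) \<and>
     (\<forall>S. connected_subdiagram I adj S \<longrightarrow>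
        (\<forall>a\<in>positive_roots S adj. restrict_coweight S l \<noteq> - coroot S adj a))"
    then show "\<exists>is\<in>lists I. firing l is \<and> dominant I (word_prod I adj is l)"
      using restrict_eq_if_obstructed[OF assms(2)] by (intro unobstructed_firing assms(2)) blast+
  qed
qed

end
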